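(* Let $$\mathbf H(\mathbf c,\mathbf b)=\mathbf D(\hat{\mathbf c})\left(\mathbf D(\mathbf g)+A_r(\mathbf b)\mathbf D(\hat{\mathbf c})+\gamma\,\mathbf 1\hat{\mathbf c}^T\right).$$ The action of $\mathbf H(\mathbf c,\mathbf b)^{-1}$ applied to any vector can be computed in $\mathcal O(n)$ operations. This is due to the Sherman–Morrison formula and the facts that $$\mathbf D(\mathbf g)+A_r(\mathbf b)\mathbf D(\hat{\mathbf c})=\left(\mathbf D(\mathbf g)\mathbf D(\hat{\mathbf c})^{-1}A_r(\mathbf b)^{-1}+I\right)A_r(\mathbf b)\mathbf D(\hat{\mathbf c})$$ and that $A_r(\mathbf b)^{-1}$ is tri-diagonal.
   Context: Let $n\ge1$, $0=b_0<b_1<\cdots<b_n<b_{n+1}=1$, $\mathbf b=(b_1,\dots,b_n)^T$, $\mathbf c=(c_0,\dots,c_n)^T\in\mathbb R^{n+1}$, $\alpha,\beta\in\mathbb R$, $\gamma>0$, and let $a,r,f$ be real-valued functions on $(0,1)$ with $a,r\in L^\infty(0,1)$ and, almost everywhere, $a\ge a_0$ and $r\ge r_0$ for constants $a_0>0$ and $r_0\ge0$. Let $\sigma(t)=\max\{0,t\}$, let $H$ be the Heaviside function ($H(t)=1$ for $t>0$, $H(0)=\tfrac12$, $H(t)=0$ for $t<0$), and let $u_n(x)=\alpha+c_0x+\sum_{i=1}^n c_i\sigma(x-b_i)$, with $u_n'(b_i):=\sum_{l=0}^{i-1}c_l+\frac{c_i}{2}$. The function $a$ is assumed differentiable at each $b_i$,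 and $g_i=r(b_i)u_n(b_i)-f(b_i)-a'(b_i)u_n'(b_i)$ for $i=1,\dots,n$. Further, $\mathbf D(\mathbf g)=\mathrm{diag}(g_1,\dots,g_n)$, $\hat{\mathbf c}=(c_1,\dots,c_n)^T$, $\mathbf D(\hat{\mathbf c})=\mathrm{diag}(c_1,\dots,c_n)$, $\mathbf 1=(1,\dots,1)^T\in\mathbb R^n$, $I$ is the $n\times n$ identity matrix, and $A_r(\mathbf b)$ is the $n\times n$ matrix with entries $\int_0^1 r(x)H(x-b_i)H(x-b_j)\,dx$, $i,j=1,\dots,n$. When $c_i\neq0$ for all $i=1,\dots,n$ (the setting in which $\mathbf H$ is introduced), $\mathbf H(\mathbf c,\mathbf b)$ is the Hessian with respect to $\mathbf b$ of $J(u_n)$, where $J(v)=\frac12\int_0^1a(v')^2dx+\frac12\int_0^1rv^2dx-\int_0^1fv\,dx+\frac\gamma2(v(1)-\beta)^2$. *)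

theory Defs
  imports
    "HOL-Analysis.Lebesgue_Measure"
    "HOL-Library.Landau_Symbols"
    "Jordan_Normal_Form.Gauss_Jordan_Elimination"
begin

definition relu :: "real \<Rightarrow> real" where
  "relu t = max 0 t"

definition heaviside :: "real \<Rightarrow> real" where
  "heaviside t = (if t > 0 then 1 else if t = 0 then 1 / 2 else 0)"

text \<open>Functions on the open unit interval are represented by total functions of which only the
  values on \<open>(0,1)\<close> matter.\<close>

abbreviation unit_measure :: "real measure" where
  "unit_measure \<equiv> lebesgue_on {0<..<1}"

definition in_Linfty :: "(real \<Rightarrow> real) \<Rightarrow> bool" where
  "in_Linfty h \<longleftrightarrow> h \<in> borel_measurable unit_measure \<and>
     (\<exists>K. AE x in unit_measure. \<bar>h x\<bar> \<le> K)"

text \<open>The breakpoints are \<open>b 1, \<dots>, b n\<close>, framed by \<open>b 0 = 0\<close> and \<open>b (n + 1) = 1\<close>; the network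
  coefficients are \<open>c 0, \<dots>, c n\<close>.\<close>

definition network :: "nat \<Rightarrow> real \<Rightarrow> (nat \<Rightarrow> real) \<Rightarrow> (nat \<Rightarrow> real) \<Rightarrow> real \<Rightarrow> real" where
  "network n \<alpha> c b x = \<alpha> + c 0 * x + (\<Sum>i = 1..n. c i * relu (x - b i))"

text \<open>The value assigned to the derivative of the network at the breakpoint \<open>b i\<close>, where
  the network need not be differentiable.\<close>

definition network_slope :: "(nat \<Rightarrow> real) \<Rightarrow> nat \<Rightarrow> real" where
  "network_slope c i = (\<Sum>l<i. c l) + c i / 2"

definition g_coeff ::
  "nat \<Rightarrow> real \<Rightarrow> (nat \<Rightarrow> real) \<Rightarrow> (nat \<Rightarrow> real) \<Rightarrow> (real \<Rightarrow> real) \<Rightarrow> (real \<Rightarrow> real) \<Rightarrow> (real \<Rightarrow> real)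
     \<Rightarrow> nat \<Rightarrow> real" where
  "g_coeff n \<alpha> c b a r f i =
     r (b i) * network n \<alpha> c b (b i) - f (b i) - deriv a (b i) * network_slope c i"

definition ritz_setting ::
  "nat \<Rightarrow> (nat \<Rightarrow> real) \<Rightarrow> real \<Rightarrow> (real \<Rightarrow> real) \<Rightarrow> (real \<Rightarrow> real) \<Rightarrow> real \<Rightarrow> real \<Rightarrow> bool" where
  "ritz_setting n b \<gamma> a r a0 r0 \<longleftrightarrow>
     n \<ge> 1 \<and> b 0 = 0 \<and> b (n + 1) = 1 \<and> (\<forall>i\<le>n. b i < b (i + 1)) \<and> \<gamma> > 0 \<and>
     in_Linfty a \<and> in_Linfty r \<and> a0 > 0 \<and> r0 \<ge> 0 \<and>
     (AE x in unit_measure. a x \<ge> a0) \<and> (AE x in unit_measure. r x \<ge> r0) \<and>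
     (\<forall>i\<in>{1..n}. a differentiable (at (b i)))"

text \<open>Matrices and vectors are indexed from \<open>0\<close>, hence the shifts by \<open>Suc\<close>.\<close>

definition c_hat :: "nat \<Rightarrow> (nat \<Rightarrow> real) \<Rightarrow> real vec" where
  "c_hat n c = vec n (\<lambda>i. c (Suc i))"

definition g_vec ::
  "nat \<Rightarrow> real \<Rightarrow> (nat \<Rightarrow> real) \<Rightarrow> (nat \<Rightarrow> real) \<Rightarrow> (real \<Rightarrow> real) \<Rightarrow> (real \<Rightarrow> real) \<Rightarrow> (real \<Rightarrow> real)
     \<Rightarrow> real vec" where
  "g_vec n \<alpha> c b a r f = vec n (\<lambda>i. g_coeff n \<alpha> c b a r f (Suc i))"

definition diag_of :: "real vec \<Rightarrow> real mat" where
  "diag_of v = mat_diag (dim_vec v) (\<lambda>i. v $ i)"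

definition A_mat :: "nat \<Rightarrow> (real \<Rightarrow> real) \<Rightarrow> (nat \<Rightarrow> real) \<Rightarrow> real mat" where
  "A_mat n r b = mat n n (\<lambda>(i, j).
     integral\<^sup>L unit_measure (\<lambda>x. r x * heaviside (x - b (Suc i)) * heaviside (x - b (Suc j))))"

definition ones_times_row :: "real vec \<Rightarrow> real mat" where
  "ones_times_row v =
     mat_of_cols (dim_vec v) [vec (dim_vec v) (\<lambda>_. 1)] * mat_of_rows (dim_vec v) [v]"

definition H_mat ::
  "nat \<Rightarrow> real \<Rightarrow> real \<Rightarrow> (nat \<Rightarrow> real) \<Rightarrow> (nat \<Rightarrow> real) \<Rightarrow> (real \<Rightarrow> real) \<Rightarrow> (real \<Rightarrow> real)
     \<Rightarrow> (real \<Rightarrow> real) \<Rightarrow> real mat" where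
  "H_mat n \<alpha> \<gamma> c b a r f =
     diag_of (c_hat n c) *
       (diag_of (g_vec n \<alpha> c b a r f) + A_mat n r b * diag_of (c_hat n c)
         + \<gamma> \<cdot>\<^sub>m ones_times_row (c_hat n c))"

text \<open>Only meaningful for invertible matrices.\<close>

abbreviation mat_inv :: "real mat \<Rightarrow> real mat" where
  "mat_inv A \<equiv> the (mat_inverse A)"

definition tridiagonal :: "real mat \<Rightarrow> bool" where
  "tridiagonal A \<longleftrightarrow>
     (\<forall>i<dim_row A. \<forall>j<dim_col A. i + 1 < j \<or> j + 1 < i \<longrightarrow> A $$ (i, j) = 0)"

text \<open>
  Programs work on natural-number registers, which serve only as counters and array indices, and
  on finitely many one-dimensional arrays of reals. A location \<open>(m, i)\<close> denotes the entry of array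
  \<open>m\<close> whose index is the current content of register \<open>i\<close>. In addition there is a read-only input
  matrix, of which single entries can be fetched. Every executed instruction and every evaluation
  of a test costs one unit, so the cost bounds in particular the number of arithmetic operations
  and of matrix entries that are looked at.
\<close>

type_synonym loc = "nat \<times> nat"

datatype arith_op = RAdd | RSub | RMul | RDiv

datatype com =
    NSet nat nat
  | NCopy nat nat
  | NSucc nat
  | NPred nat
  | RSet loc int
  | RCopy loc loc
  | ROp arith_op loc loc loc
  | RFetch loc nat nat
  | Seq com com
  | IfLess loc loc com com
  | WhileLess nat nat com

type_synonym state = "(nat \<Rightarrow> nat) \<times> (nat \<Rightarrow> nat \<Rightarrow> real)"

fun get :: "state \<Rightarrow> loc \<Rightarrow> real" where
  "get (N, M) (m, i) = M m (N i)"

fun put :: "state \<Rightarrow> loc \<Rightarrow> real \<Rightarrow> state" where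
  "put (N, M) (m, i) x = (N, M(m := (M m)(N i := x)))"

fun put_nat :: "state \<Rightarrow> nat \<Rightarrow> nat \<Rightarrow> state" where
  "put_nat (N, M) i k = (N(i := k), M)"

fun arith_val :: "arith_op \<Rightarrow> real \<Rightarrow> real \<Rightarrow> real" where
  "arith_val RAdd x y = x + y"
| "arith_val RSub x y = x - y"
| "arith_val RMul x y = x * y"
| "arith_val RDiv x y = x / y"

text \<open>\<open>exec A P s t s'\<close>: with input matrix \<open>A\<close>, the program \<open>P\<close> started in state \<open>s\<close> terminates in
  state \<open>s'\<close> at cost \<open>t\<close>. Division by zero and fetching outside of the matrix get stuck.\<close>

inductive exec :: "real mat \<Rightarrow> com \<Rightarrow> state \<Rightarrow> nat \<Rightarrow> state \<Rightarrow> bool" for A where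
  NSet: "exec A (NSet i k) s 1 (put_nat s i k)"
| NCopy: "exec A (NCopy i j) s 1 (put_nat s i (fst s j))"
| NSucc: "exec A (NSucc i) s 1 (put_nat s i (fst s i + 1))"
| NPred: "exec A (NPred i) s 1 (put_nat s i (fst s i - 1))"
| RSet: "exec A (RSet l k) s 1 (put s l (of_int k))"
| RCopy: "exec A (RCopy l l1) s 1 (put s l (get s l1))"
| ROp: "(opr = RDiv \<Longrightarrow> get s l2 \<noteq> 0) \<Longrightarrow>
    exec A (ROp opr l l1 l2) s 1 (put s l (arith_val opr (get s l1) (get s l2)))"
| RFetch: "fst s i < dim_row A \<Longrightarrow> fst s j < dim_col A \<Longrightarrow>
    exec A (RFetch l i j) s 1 (put s l (A $$ (fst s i, fst s j)))"
| Seq: "exec A P s t s' \<Longrightarrow> exec A Q s' t' s'' \<Longrightarrow> exec A (Seq P Q) s (t + t') s''"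
| IfTrue: "get s l1 < get s l2 \<Longrightarrow> exec A P s t s' \<Longrightarrow> exec A (IfLess l1 l2 P Q) s (1 + t) s'"
| IfFalse: "\<not> get s l1 < get s l2 \<Longrightarrow> exec A Q s t s' \<Longrightarrow> exec A (IfLess l1 l2 P Q) s (1 + t) s'"
| WhileStop: "\<not> fst s i < fst s j \<Longrightarrow> exec A (WhileLess i j P) s 1 s"
| WhileStep: "fst s i < fst s j \<Longrightarrow> exec A P s t s' \<Longrightarrow> exec A (WhileLess i j P) s' t' s'' \<Longrightarrow>
    exec A (WhileLess i j P) s (1 + t + t') s''"

definition vec_array :: "real vec \<Rightarrow> nat \<Rightarrow> real" where
  "vec_array v i = (if i < dim_vec v then v $ i else 0)"

text \<open>Initially register \<open>0\<close> contains the dimension, the arrays \<open>0\<close>, \<open>1\<close>, \<open>2\<close> contain three given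
  vectors, and entry \<open>0\<close> of array \<open>3\<close> contains a given scalar; everything else is \<open>0\<close>.\<close>

definition init_state :: "nat \<Rightarrow> real vec \<Rightarrow> real vec \<Rightarrow> real vec \<Rightarrow> real \<Rightarrow> state" where
  "init_state n x y z \<gamma> =
     ((\<lambda>_. 0)(0 := n),
      (\<lambda>_ _. 0)(0 := vec_array x, 1 := vec_array y, 2 := vec_array z, 3 := (\<lambda>_. 0)(0 := \<gamma>)))"

text \<open>The result is read off from array \<open>4\<close>.\<close>

definition computes_within ::
  "com \<Rightarrow> nat \<Rightarrow> real mat \<Rightarrow> real vec \<Rightarrow> real vec \<Rightarrow> real vec \<Rightarrow> real \<Rightarrow> real vec \<Rightarrow> nat \<Rightarrow> bool" where
  "computes_within P n A x y z \<gamma> out T \<longleftrightarrow>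
     (\<exists>t s'. exec A P (init_state n x y z \<gamma>) t s' \<and> t \<le> T \<and> vec n (snd s' 4) = out)"

end

(*
  With y = D(c) x, the system H x = v becomes g_i x_i + sum_j p(max i j) y_j = v_i / c_i, where
  p(k) is the integral of r over (b_k, 1) plus gamma: the kernel depends on max i j only, and the
  rank-one term is absorbed into it. Subtracting consecutive rows leaves a two-term recursion for
  the flux F_i = g_i x_i and the partial sum S_i = sum_(j<i) y_j, with boundary values S_0 = 0 and
  F_n = 0. A forward sweep propagates one linear relation alpha F_i + beta S_i = kappa, restarted
  from F_i = 0 wherever g_i = 0; a backward sweep then recovers F, S and x. Neither sweep requires
  A_r or D(g) + A_r D(c) to be invertible, unlike the
  Sherman-Morrison formula. The same row differences show that A_r^(-1) is tridiagonal.
*)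
theory Submission
  imports Defs "Jordan_Normal_Form.Determinant"
begin

subsection \<open>Kernels depending on the maximum of the indices\<close>

text \<open>Rows i and i + 1 of the kernel agree in the columns j > i, and are constant, with values
  \<open>p i\<close> and \<open>p (Suc i)\<close>, in the columns j \<le> i. Hence only a partial
  sum of \<open>y\<close> survives.\<close>

lemma max_kernel_row_difference:
  fixes p y :: "nat \<Rightarrow> real"
  assumes "i < n"
  shows "(\<Sum>j<n. p (max i j) * y j) - (\<Sum>j<n. p (max (Suc i) j) * y j) =
    (p i - p (Suc i)) * (\<Sum>j<Suc i. y j)"
proof -
  have "(\<Sum>j<n. p (max i j) * y j) - (\<Sum>j<n. p (max (Suc i) j) * y j) =
      (\<Sum>j<n. if j < Suc i then (p i - p (Suc i)) * y j else 0)"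
    unfolding sum_subtractf[symmetric]
  proof (rule sum.cong[OF refl])
    fix j
    consider "j < i" | "j = i" | "i < j" by linarith
    then show "p (max i j) * y j - p (max (Suc i) j) * y j =
        (if j < Suc i then (p i - p (Suc i)) * y j else 0)"
      by cases (simp_all add: max_def algebra_simps)
  qed
  also have "\<dots> = (\<Sum>j<Suc i. (p i - p (Suc i)) * y j)"
    by (rule sum.mono_neutral_cong_right) (use assms in auto)
  finally show ?thesis
    by (simp only: sum_distrib_left)
qed

text \<open>The facts on determinants and on \<open>mat_inverse\<close> speak of units of the matrix
  ring; this carries them over to \<open>invertible_mat\<close>.\<close>

lemma invertible_mat_iff_Units:
  fixes A :: "'a :: field mat"
  assumes A: "A \<in> carrier_mat n n"
  shows "invertible_mat A \<longleftrightarrow> A \<in> Units (ring_mat TYPE('a) n ())"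
proof
  assume "invertible_mat A"
  then obtain B where B: "A * B = 1\<^sub>m n" "B * A = 1\<^sub>m (dim_row B)"
    using A by (auto simp: invertible_mat_def inverts_mat_def)
  then have "B \<in> carrier_mat n n"
    using A by (metis carrier_matD(2) carrier_matI index_mult_mat(3) index_one_mat(3))
  then show "A \<in> Units (ring_mat TYPE('a) n ())"
    using A B by (auto simp: Units_def ring_mat_def)
next
  assume "A \<in> Units (ring_mat TYPE('a) n ())"
  then show "invertible_mat A"
    by (auto simp: Units_def ring_mat_def invertible_mat_def inverts_mat_def square_mat.simps)
qed

lemma mat_inverse_invertible_mat:
  assumes A: "A \<in> carrier_mat n n" and "invertible_mat A"
  shows "mat_inv A \<in> carrier_mat n n" "A * mat_inv A = 1\<^sub>m n" "mat_inv A * A = 1\<^sub>m n"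
proof -
  have "mat_inverse A \<noteq> None"
    using mat_inverse(1)[OF A, where b = "()"] assms(2) invertible_mat_iff_Units[OF A] by auto
  then obtain B where B: "mat_inverse A = Some B" by auto
  show "mat_inv A \<in> carrier_mat n n" "A * mat_inv A = 1\<^sub>m n" "mat_inv A * A = 1\<^sub>m n"
    using mat_inverse(2)[OF A B] B by auto
qed

section \<open>Matrices with a max kernel: tridiagonal inverse and invertibility\<close>

lemma mult_mat_entry_sum:
  assumes "A \<in> carrier_mat n n" "B \<in> carrier_mat n m" "i < n" "k < m"
  shows "(A * B) $$ (i, k) = (\<Sum>j<n. A $$ (i, j) * B $$ (j, k))"
  using assms by (auto simp: scalar_prod_def lessThan_atLeast0 intro!: sum.cong)

text \<open>The convention \<open>p n = 0\<close> appends a zero row of index n, so that the last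
  row is differenced like all others.\<close>

lemma max_kernel_mult_row_difference:
  fixes A B :: "real mat"
  assumes A: "A \<in> carrier_mat n n" and B: "B \<in> carrier_mat n m"
    and entry: "\<And>i j. i < n \<Longrightarrow> j < n \<Longrightarrow> A $$ (i, j) = p (max i j)"
    and "p n = 0" "i < n" "k < m"
  shows "(A * B) $$ (i, k) - (if Suc i < n then (A * B) $$ (Suc i, k) else 0) =
    (p i - p (Suc i)) * (\<Sum>j<Suc i. B $$ (j, k))"
proof -
  have row: "(\<Sum>j<n. p (max l j) * B $$ (j, k)) = (if l < n then (A * B) $$ (l, k) else 0)"
    if "l \<le> n" for l
    using that assms(4,6) mult_mat_entry_sum[OF A B, of l k] entry
    by (auto simp: max_absorb1)
  show ?thesis
    using max_kernel_row_difference[OF \<open>i < n\<close>, of p "\<lambda>j. B $$ (j, k)"] row[of i] row[of "Suc i"] \<open>i < n\<close>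
    by simp
qed

text \<open>Column k of the identity has nonzero row differences only at i = k and i + 1 = k. So the
  partial sums of column k of \<open>B\<close> vanish except those of length k and k + 1, and an
  entry is a difference of consecutive partial sums.\<close>

lemma tridiagonal_max_kernel_inverse:
  fixes A B :: "real mat"
  assumes A: "A \<in> carrier_mat n n" and B: "B \<in> carrier_mat n n" and AB: "A * B = 1\<^sub>m n"
    and entry: "\<And>i j. i < n \<Longrightarrow> j < n \<Longrightarrow> A $$ (i, j) = p (max i j)"
    and pn: "p n = 0"
  shows "tridiagonal B"
proof -
  define S where "S i k = (\<Sum>j<i. B $$ (j, k))" for i k
  have S: "(p i - p (Suc i)) * S (Suc i) k = (if k = i then 1 else 0) - (if k = Suc i then 1 else 0)"
    if "i < n" "k < n" for i k
    using max_kernel_mult_row_difference[OF A B entry pn that] that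
    by (cases "k = i"; cases "k = Suc i") (simp_all add: AB S_def split: if_splits)
  have S0: "S (Suc i) k = 0" if "i < n" "k < n" "k \<noteq> i" "k \<noteq> Suc i" for i k
  proof -
    \<comment> \<open>In column k = i the right-hand side of \<open>S\<close> is 1, so
      \<open>A * B = 1\<^sub>m n\<close> itself forces consecutive values of \<open>p\<close> to
      differ.\<close>
    have "p i - p (Suc i) \<noteq> 0"
      using S[of i i] that by auto
    then show ?thesis
      using S[of i k] that by simp
  qed
  have "B $$ (i, k) = 0" if "i < n" "k < n" "i + 1 < k \<or> k + 1 < i" for i k
  proof -
    have "S i k = 0"
      using S0[of "i - 1" k] that by (cases i) (auto simp: S_def)
    moreover have "S (Suc i) k = S i k + B $$ (i, k)"
      by (simp add: S_def)
    ultimately show ?thesis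
      using S0[of i k] that by auto
  qed
  then show ?thesis
    using B by (auto simp: tridiagonal_def)
qed

text \<open>A vector in the null space has zero row differences, so all its partial sums vanish, and
  with them all its entries.\<close>

lemma max_kernel_invertible:
  fixes A :: "real mat"
  assumes A: "A \<in> carrier_mat n n"
    and entry: "\<And>i j. i < n \<Longrightarrow> j < n \<Longrightarrow> A $$ (i, j) = p (max i j)"
    and pn: "p n = 0" and neq: "\<And>i. i < n \<Longrightarrow> p i \<noteq> p (Suc i)"
  shows "invertible_mat A"
proof (rule ccontr)
  assume "\<not> invertible_mat A"
  then have "Determinant.det A = 0"
    using det_non_zero_imp_unit[OF A, where b = "()"] invertible_mat_iff_Units[OF A] by blast
  then obtain v where v: "v \<in> carrier_vec n" "v \<noteq> 0\<^sub>v n" "A *\<^sub>v v = 0\<^sub>v n"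
    using det_0_iff_vec_prod_zero_field[OF A] by auto
  \<comment> \<open>The vector is turned into a one-column matrix so that the row difference of a
    product applies.\<close>
  define B where "B = mat_of_cols n [v]"
  have B: "B \<in> carrier_mat n 1" and B_entry: "\<And>j. j < n \<Longrightarrow> B $$ (j, 0) = v $ j"
    by (auto simp: B_def mat_of_cols_index)
  have "(A * B) $$ (i, 0) = 0" if "i < n" for i
  proof -
    have "(A * B) $$ (i, 0) = (A *\<^sub>v v) $ i"
      using that A B v(1) by (simp add: B_def)
    then show ?thesis using v(3) that by simp
  qed
  then have S: "(\<Sum>j<Suc i. B $$ (j, 0)) = 0" if "i < n" for i
    using max_kernel_mult_row_difference[OF A B entry pn that, of 0] that neq[of i]
    by (auto split: if_splits)
  have "v $ i = 0" if "i < n" for i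
    using S[of i] S[of "i - 1"] that B_entry[of i] by (cases i) auto
  then have "v = 0\<^sub>v n"
    using v(1) by (intro eq_vecI) auto
  with v(2) show False by contradiction
qed

subsection \<open>The mass matrix\<close>

text \<open>For t in [0,1] this is the integral of \<open>r\<close> over (t,1); the value 1/2 at the
  jump matters on a null set only.\<close>

definition tail_integral :: "(real \<Rightarrow> real) \<Rightarrow> real \<Rightarrow> real" where
  "tail_integral r t = integral\<^sup>L unit_measure (\<lambda>x. r x * heaviside (x - t))"

lemma heaviside_measurable: "(\<lambda>x. heaviside (x - t)) \<in> borel_measurable unit_measure"
proof -
  have "(\<lambda>x. heaviside (x - t)) \<in> borel_measurable borel"
    unfolding heaviside_def by measurable
  then show ?thesis
    by (metis borel_measurable_if_lebesgue_on measurable_completion measurable_lborel2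
        measurable_restrict_space1)
qed

lemma unit_measure_integrable_const: "integrable unit_measure (\<lambda>x. K :: real)"
  by (simp add: emeasure_restrict_space finite_measure.integrable_const finite_measureI
      space_restrict_space)

lemma in_Linfty_heaviside_integrable:
  assumes "in_Linfty r"
  shows "integrable unit_measure (\<lambda>x. r x * heaviside (x - t))"
proof -
  obtain K where K: "AE x in unit_measure. \<bar>r x\<bar> \<le> K" and r: "r \<in> borel_measurable unit_measure"
    using assms by (auto simp: in_Linfty_def)
  show ?thesis
  proof (rule Bochner_Integration.integrable_bound[OF unit_measure_integrable_const])
    show "(\<lambda>x. r x * heaviside (x - t)) \<in> borel_measurable unit_measure"
      using r heaviside_measurable[of t] by simp
    show "AE x in unit_measure. norm (r x * heaviside (x - t)) \<le> norm K"
      using K by eventually_elim (auto simp: heaviside_def)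
  qed
qed

text \<open>At x = s = t the two sides would be 1/4 and 1/2, which is why the jump points are
  excluded.\<close>

lemma heaviside_mult_eq_max:
  assumes "x \<noteq> s" "x \<noteq> t"
  shows "heaviside (x - s) * heaviside (x - t) = heaviside (x - max s t)"
  using assms by (auto simp: heaviside_def)

lemma AE_unit_measure_neq: "AE x in unit_measure. x \<noteq> t"
proof -
  have "AE x in lebesgue. x \<noteq> t"
    by (rule AE_completion) (rule AE_lborel_singleton)
  then show ?thesis
    by (subst AE_restrict_space_iff) (auto elim: eventually_mono)
qed

lemma ritz_breakpoints_strict_mono:
  assumes "ritz_setting n b \<gamma> a r a0 r0" "i < j" "j \<le> n + 1"
  shows "b i < b j"
  using assms(2,3)
proof (induction j)
  case (Suc j)
  have "b j < b (j + 1)"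
    using assms(1) Suc.prems by (auto simp: ritz_setting_def)
  then show ?case
    using Suc by (cases "i = j") (auto intro: less_trans)
qed simp

text \<open>Almost everywhere the two Heaviside factors merge into the one at the larger breakpoint,
  and the breakpoints increase with their index.\<close>

lemma A_mat_entry:
  assumes R: "ritz_setting n b \<gamma> a r a0 r0" and "i < n" "j < n"
  shows "A_mat n r b $$ (i, j) = tail_integral r (b (Suc (max i j)))"
proof -
  have b_max: "max (b (Suc i)) (b (Suc j)) = b (Suc (max i j))"
    using ritz_breakpoints_strict_mono[OF R, of "Suc i" "Suc j"]
      ritz_breakpoints_strict_mono[OF R, of "Suc j" "Suc i"] assms(2,3)
    by (cases i j rule: linorder_cases) (auto simp: max_def)
  have "integral\<^sup>L unit_measure (\<lambda>x. r x * heaviside (x - b (Suc i)) * heaviside (x - b (Suc j))) =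
      tail_integral r (b (Suc (max i j)))"
    unfolding tail_integral_def
  proof (rule integral_cong_AE)
    have "in_Linfty r"
      using R by (simp add: ritz_setting_def)
    from in_Linfty_heaviside_integrable[OF this]
    show "(\<lambda>x. r x * heaviside (x - b (Suc (max i j)))) \<in> borel_measurable unit_measure"
      by auto
    show "(\<lambda>x. r x * heaviside (x - b (Suc i)) * heaviside (x - b (Suc j)))
        \<in> borel_measurable unit_measure"
      using \<open>in_Linfty r\<close> heaviside_measurable
      by (auto simp: in_Linfty_def intro!: borel_measurable_times)
    show "AE x in unit_measure. r x * heaviside (x - b (Suc i)) * heaviside (x - b (Suc j)) =
        r x * heaviside (x - b (Suc (max i j)))"
      using AE_unit_measure_neq[of "b (Suc i)"] AE_unit_measure_neq[of "b (Suc j)"]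
      by eventually_elim (simp add: heaviside_mult_eq_max b_max mult.assoc)
  qed
  then show ?thesis
    using assms(2,3) by (simp add: A_mat_def)
qed

text \<open>Off the points s and t the Heaviside factors differ by the indicator of (s,t), leaving
  the integral of \<open>r\<close> over (s,t). For r0 > 0 this separates consecutive kernel
  values.\<close>

lemma tail_integral_diff_ge:
  assumes r: "in_Linfty r" and ge: "AE x in unit_measure. r x \<ge> r0"
    and "0 \<le> s" "s \<le> t" "t \<le> 1"
  shows "r0 * (t - s) \<le> tail_integral r s - tail_integral r t"
proof -
  have "r0 * (t - s) = integral\<^sup>L unit_measure (\<lambda>x. r0 * indicator {s<..<t} x)"
  proof -
    have "integral\<^sup>L unit_measure (\<lambda>x. indicator {s<..<t} x :: real) =
        measure unit_measure ({s<..<t} \<inter> {0<..<1})"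
      by simp
    also have "\<dots> = t - s"
      using assms(3-5) by (subst measure_restrict_space)
        (auto simp: Int_absorb2 greaterThanLessThan_subseteq_greaterThanLessThan)
    finally show ?thesis by simp
  qed
  also have "\<dots> \<le> integral\<^sup>L unit_measure (\<lambda>x. r x * heaviside (x - s) - r x * heaviside (x - t))"
  proof (rule integral_mono_AE)
    show "integrable unit_measure (\<lambda>x. r0 * indicator {s<..<t} x)"
    proof (rule Bochner_Integration.integrable_bound[OF unit_measure_integrable_const])
      show "(\<lambda>x. r0 * indicator {s<..<t} x) \<in> borel_measurable unit_measure"
        by (intro borel_measurable_times borel_measurable_const borel_measurable_indicator')
          (use assms(3-5) in \<open>auto simp: sets_restrict_space_iff\<close>)
      show "AE x in unit_measure. norm (r0 * indicator {s<..<t} x) \<le> norm r0"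
        by (auto simp: indicator_def)
    qed
    show "integrable unit_measure (\<lambda>x. r x * heaviside (x - s) - r x * heaviside (x - t))"
      by (intro Bochner_Integration.integrable_diff in_Linfty_heaviside_integrable r)
    show "AE x in unit_measure. r0 * indicator {s<..<t} x \<le>
        r x * heaviside (x - s) - r x * heaviside (x - t)"
      using ge AE_unit_measure_neq[of s] AE_unit_measure_neq[of t]
      by eventually_elim (use \<open>s \<le> t\<close> in \<open>auto simp: heaviside_def indicator_def\<close>)
  qed
  also have "\<dots> = tail_integral r s - tail_integral r t"
    unfolding tail_integral_def
    by (rule Bochner_Integration.integral_diff) (rule in_Linfty_heaviside_integrable[OF r])+
  finally show ?thesis .
qed

text \<open>As \<open>b (n + 1) = 1\<close>, this provides the condition \<open>p n = 0\<close> of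
  the kernel lemmas.\<close>

lemma tail_integral_1: "tail_integral r 1 = 0"
proof -
  have "tail_integral r 1 = integral\<^sup>L unit_measure (\<lambda>x. 0)"
    unfolding tail_integral_def
    by (rule Bochner_Integration.integral_cong) (auto simp: heaviside_def space_restrict_space)
  then show ?thesis by simp
qed

section \<open>Invertibility of A_r and the shape of its inverse\<close>

lemma c_hat_carrier [simp]: "c_hat n c \<in> carrier_vec n"
  and g_vec_carrier [simp]: "g_vec n \<alpha> c b a r f \<in> carrier_vec n"
  and A_mat_carrier [simp]: "A_mat n r b \<in> carrier_mat n n"
  by (simp_all add: c_hat_def g_vec_def A_mat_def)

lemma A_mat_max_kernel:
  assumes R: "ritz_setting n b \<gamma> a r a0 r0" and "i < n" "j < n"
  shows "A_mat n r b $$ (i, j) = (\<lambda>k. tail_integral r (b (Suc k))) (max i j)"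
  using A_mat_entry[OF assms] by simp

lemma A_mat_invertible:
  assumes R: "ritz_setting n b \<gamma> a r a0 r0" and "r0 > 0"
  shows "invertible_mat (A_mat n r b)"
proof (rule max_kernel_invertible[OF A_mat_carrier A_mat_max_kernel[OF R]])
  have b: "b 0 = 0" "b (Suc n) = 1" and r: "in_Linfty r" "AE x in unit_measure. r x \<ge> r0"
    using R by (auto simp: ritz_setting_def)
  show "tail_integral r (b (Suc n)) = 0"
    by (simp add: b tail_integral_1)
  fix i assume i: "i < n"
  have "b 0 < b (Suc i)" "b (Suc i) < b (Suc (Suc i))" "b (Suc (Suc i)) \<le> b (Suc n)"
    using ritz_breakpoints_strict_mono[OF R, of 0 "Suc i"] i
      ritz_breakpoints_strict_mono[OF R, of "Suc i" "Suc (Suc i)"]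
      ritz_breakpoints_strict_mono[OF R, of "Suc (Suc i)" "Suc n"]
    by (cases "Suc i = n"; auto)+
  then have "0 < r0 * (b (Suc (Suc i)) - b (Suc i))"
    "r0 * (b (Suc (Suc i)) - b (Suc i)) \<le>
       tail_integral r (b (Suc i)) - tail_integral r (b (Suc (Suc i)))"
    using \<open>r0 > 0\<close> b by (auto intro!: tail_integral_diff_ge[OF r])
  then show "tail_integral r (b (Suc i)) \<noteq> tail_integral r (b (Suc (Suc i)))"
    by linarith
qed

lemma A_mat_inverse_tridiagonal:
  assumes R: "ritz_setting n b \<gamma> a r a0 r0" and inv: "invertible_mat (A_mat n r b)"
  shows "tridiagonal (mat_inv (A_mat n r b))"
proof (rule tridiagonal_max_kernel_inverse[OF A_mat_carrier _ _ A_mat_max_kernel[OF R]])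
  show "tail_integral r (b (Suc n)) = 0"
    using R by (simp add: ritz_setting_def tail_integral_1)
qed (use mat_inverse_invertible_mat[OF A_mat_carrier inv] in auto)

subsection \<open>The factorization\<close>

lemma diag_of_carrier [simp]: "v \<in> carrier_vec n \<Longrightarrow> diag_of v \<in> carrier_mat n n"
  by (auto simp: diag_of_def mat_diag_def)

text \<open>Multiplying out the right-hand side from the left cancels \<open>mat_inv A * A\<close>
  first and \<open>mat_inv C * C\<close> next.\<close>

lemma add_mult_factorization:
  fixes A G C :: "real mat"
  assumes A: "A \<in> carrier_mat n n" and G: "G \<in> carrier_mat n n" and C: "C \<in> carrier_mat n n"
    and "invertible_mat A" "invertible_mat C"
  shows "G + A * C = (G * mat_inv C * mat_inv A + 1\<^sub>m n) * A * C"
proof -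
  note iA = mat_inverse_invertible_mat[OF A assms(4)]
  note iC = mat_inverse_invertible_mat[OF C assms(5)]
  have GC: "G * mat_inv C \<in> carrier_mat n n"
    using G iC(1) by simp
  have "(G * mat_inv C * mat_inv A + 1\<^sub>m n) * A = G * mat_inv C * mat_inv A * A + A"
    using A iA(1) GC by (simp add: add_mult_distrib_mat[of _ n n _ _ n])
  also have "G * mat_inv C * mat_inv A * A = G * mat_inv C"
    using GC by (simp only: assoc_mult_mat[OF GC iA(1) A] iA(3) right_mult_one_mat[OF GC])
  finally have "(G * mat_inv C * mat_inv A + 1\<^sub>m n) * A * C = G * mat_inv C * C + A * C"
    using A C GC by (simp add: add_mult_distrib_mat[of _ n n _ _ n])
  also have "G * mat_inv C * C = G"
    using G by (simp add: assoc_mult_mat[OF G iC(1) C] iC(3))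
  finally show ?thesis by simp
qed

lemma diag_of_invertible:
  assumes "\<And>i. i < dim_vec v \<Longrightarrow> v $ i \<noteq> 0"
  shows "invertible_mat (diag_of v)"
proof -
  let ?n = "dim_vec v"
  obtain E where E: "diag_of v * E = 1\<^sub>m ?n" "E * diag_of v = 1\<^sub>m ?n" "E \<in> carrier_mat ?n ?n"
  proof
    show "diag_of v * mat_diag ?n (\<lambda>i. 1 / v $ i) = 1\<^sub>m ?n"
      "mat_diag ?n (\<lambda>i. 1 / v $ i) * diag_of v = 1\<^sub>m ?n"
      using assms unfolding diag_of_def mat_diag_diag
      by (auto simp: mat_diag_def intro!: eq_matI)
  qed simp
  have D: "diag_of v \<in> carrier_mat ?n ?n"
    by (rule diag_of_carrier) (rule carrier_vec_dim_vec)
  have "square_mat (diag_of v)"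
    using carrier_matD[OF D] by (simp only: square_mat.simps)
  moreover have "inverts_mat (diag_of v) E" "inverts_mat E (diag_of v)"
    by (simp_all only: inverts_mat_def E(1,2) carrier_matD[OF D] carrier_matD[OF E(3)])
  ultimately show ?thesis
    unfolding invertible_mat_def by blast
qed

subsection \<open>Elimination in linear time\<close>

text \<open>The pair \<open>(\<alpha>, \<beta>)\<close> and the inhomogeneity \<open>\<kappa>\<close> of the relation \<open>\<alpha> F + \<beta> S = \<kappa>\<close> between
  \<open>flux\<close> and \<open>psum\<close> at an index. For \<open>g i = 0\<close> the flux itself vanishes, and the old relation is
  replaced by \<open>F = 0\<close>.\<close>

primrec elim_coeffs ::
  "(nat \<Rightarrow> real) \<Rightarrow> (nat \<Rightarrow> real) \<Rightarrow> (nat \<Rightarrow> real) \<Rightarrow> nat \<Rightarrow> real \<times> real" where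
  "elim_coeffs c g p 0 = (0, 1)"
| "elim_coeffs c g p (Suc i) =
     (let (\<alpha>, \<beta>) = elim_coeffs c g p i;
          (\<alpha>', \<beta>') = (if g i = 0 then (1, 0) else (\<alpha> - \<beta> * (c i / g i), \<beta>))
      in (\<alpha>', \<beta>' - \<alpha>' * (p i - p (Suc i))))"

text \<open>Correcting \<open>\<beta>\<close> leaves \<open>\<alpha>'\<close> unchanged, so the
  factor of the jump of \<open>w\<close> can be read off as the first coefficient at
  \<open>Suc i\<close>.\<close>

primrec elim_rhs ::
  "(nat \<Rightarrow> real) \<Rightarrow> (nat \<Rightarrow> real) \<Rightarrow> (nat \<Rightarrow> real) \<Rightarrow> (nat \<Rightarrow> real) \<Rightarrow> nat \<Rightarrow> real" where
  "elim_rhs c g p w 0 = 0"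
| "elim_rhs c g p w (Suc i) =
     (if g i = 0 then 0 else elim_rhs c g p w i)
       - fst (elim_coeffs c g p (Suc i)) * (w i - w (Suc i))"

text \<open>In the application this is H x = v with row i divided by its coefficient, and
  \<open>p\<close> contains both A_r and the rank-one term.\<close>

definition solves ::
  "nat \<Rightarrow> (nat \<Rightarrow> real) \<Rightarrow> (nat \<Rightarrow> real) \<Rightarrow> (nat \<Rightarrow> real) \<Rightarrow> (nat \<Rightarrow> real) \<Rightarrow> (nat \<Rightarrow> real) \<Rightarrow> bool" where
  "solves n c g p w x \<longleftrightarrow>
     (\<forall>i<n. g i * x i + (\<Sum>j<n. p (max i j) * (c j * x j)) = w i)"

text \<open>The cutoff builds in the terminal condition F_n = 0.\<close>

definition flux :: "nat \<Rightarrow> (nat \<Rightarrow> real) \<Rightarrow> (nat \<Rightarrow> real) \<Rightarrow> nat \<Rightarrow> real" where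
  "flux n g x i = (if i < n then g i * x i else 0)"

definition psum :: "(nat \<Rightarrow> real) \<Rightarrow> (nat \<Rightarrow> real) \<Rightarrow> nat \<Rightarrow> real" where
  "psum c x i = (\<Sum>j<i. c j * x j)"

lemma psum_Suc: "psum c x (Suc i) = psum c x i + c i * x i"
  by (simp add: psum_def)

text \<open>Consecutive rows of the system are subtracted. Row n is the trivial equation 0 = 0 by
  \<open>p n = 0\<close> and \<open>w n = 0\<close>, so i + 1 = n is included.\<close>

lemma flux_Suc:
  assumes "solves n c g p w x" "p n = 0" "w n = 0" "i < n"
  shows "flux n g x (Suc i) =
    flux n g x i + (p i - p (Suc i)) * psum c x (Suc i) - (w i - w (Suc i))"
proof -
  have row: "flux n g x k + (\<Sum>j<n. p (max k j) * (c j * x j)) = w k" if "k \<le> n" for k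
    using that assms(1-3) by (cases "k = n") (auto simp: flux_def solves_def max_absorb1)
  show ?thesis
    using row[of i] row[of "Suc i"] max_kernel_row_difference[OF assms(4), of p "\<lambda>j. c j * x j"]
      assms(4)
    by (simp only: psum_def) simp
qed

text \<open>A step either applies two shears, which are invertible, or restarts from (1, 0) and
  applies one shear.\<close>

lemma elim_coeffs_nonzero: "elim_coeffs c g p i \<noteq> (0, 0)"
  by (induction i) (auto simp: Let_def split: prod.splits)

text \<open>For g_i nonzero, S_i = S_(i+1) - (c_i / g_i) F_i changes the relation into one between
  F_i and S_(i+1); for g_i = 0 it is replaced by F_i = 0. Then \<open>flux_Suc\<close> expresses F_i
  by F_(i+1) and S_(i+1).\<close>

lemma elim_relation:
  assumes "solves n c g p w x" "p n = 0" "w n = 0" "i \<le> n"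
  shows "fst (elim_coeffs c g p i) * flux n g x i + snd (elim_coeffs c g p i) * psum c x i =
    elim_rhs c g p w i"
  using assms(4)
proof (induction i)
  case 0
  show ?case by (simp add: psum_def)
next
  case (Suc i)
  have F: "flux n g x i = g i * x i"
    using Suc.prems by (simp add: flux_def)
  obtain \<alpha> \<beta> where ab: "elim_coeffs c g p i = (\<alpha>, \<beta>)"
    by fastforce
  have IH: "\<alpha> * (g i * x i) + \<beta> * psum c x i = elim_rhs c g p w i"
    using Suc ab F by simp
  have eq: "flux n g x (Suc i) =
      g i * x i + (p i - p (Suc i)) * psum c x (Suc i) - (w i - w (Suc i))"
    using flux_Suc[OF assms(1-3), of i] Suc.prems F by simp
  define \<alpha>' where "\<alpha>' = fst (elim_coeffs c g p (Suc i))"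
  define \<beta>' where "\<beta>' = (if g i = 0 then 0 else \<beta>)"
  have snd: "snd (elim_coeffs c g p (Suc i)) = \<beta>' - \<alpha>' * (p i - p (Suc i))"
    by (simp add: \<alpha>'_def \<beta>'_def ab)
  have "\<alpha>' * (g i * x i) + \<beta>' * psum c x (Suc i) = (if g i = 0 then 0 else elim_rhs c g p w i)"
    using IH by (simp add: \<alpha>'_def \<beta>'_def ab psum_Suc algebra_simps)
  then show ?case
    unfolding eq snd elim_rhs.simps(2) \<alpha>'_def[symmetric] by (simp add: algebra_simps)
qed

text \<open>The right-hand side \<open>w = (1, \<dots>, 1, 0, \<dots>, 0)\<close> with \<open>m\<close> ones has a single jump, so that the
  relation at \<open>m\<close> has the inhomogeneity \<open>- \<alpha>\<close>; were \<open>\<beta> = 0\<close>, the relation would read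
  \<open>0 = - \<alpha>\<close>.\<close>

lemma elim_coeffs_snd_nonzero:
  assumes surj: "\<And>w. \<exists>x. solves n c g p w x"
    and "p n = 0" "m \<le> n" "m = n \<or> g m = 0"
  shows "snd (elim_coeffs c g p m) \<noteq> 0"
proof (cases m)
  case 0
  then show ?thesis by simp
next
  case (Suc k)
  define w where "w i = (if i < m then 1 else 0 :: real)" for i
  obtain x where x: "solves n c g p w x"
    using surj by blast
  have "elim_rhs c g p w i = 0" if "i < m" for i
    using that by (induction i) (auto simp: w_def)
  then have "elim_rhs c g p w m = - fst (elim_coeffs c g p m)"
    using Suc by (simp add: w_def)
  \<comment> \<open>The indices with \<open>m = n\<close> or \<open>g m = 0\<close> are exactly
    those at which the program divides by \<open>\<beta>\<close>.\<close>
  moreover have "flux n g x m = 0"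
    using assms(4) by (auto simp: flux_def)
  moreover have "w n = 0"
    using assms(3) by (simp add: w_def)
  ultimately have "snd (elim_coeffs c g p m) * psum c x m = - fst (elim_coeffs c g p m)"
    using elim_relation[OF x assms(2) _ assms(3)] by simp
  then show ?thesis
    using elim_coeffs_nonzero[of c g p m] by (auto simp: prod_eq_iff)
qed

subsection \<open>Weakest preconditions with costs\<close>

text \<open>The postcondition also receives the unspent part of the cost budget \<open>k\<close>.\<close>

definition wp ::
  "real mat \<Rightarrow> com \<Rightarrow> (state \<Rightarrow> nat \<Rightarrow> bool) \<Rightarrow> state \<Rightarrow> nat \<Rightarrow> bool" where
  "wp A P Q s k \<longleftrightarrow> (\<exists>t s'. exec A P s t s' \<and> t \<le> k \<and> Q s' (k - t))"

lemma exec_basic_iff: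
  "exec A (NSet i c) s t s' \<longleftrightarrow> t = 1 \<and> s' = put_nat s i c"
  "exec A (NCopy i j) s t s' \<longleftrightarrow> t = 1 \<and> s' = put_nat s i (fst s j)"
  "exec A (NSucc i) s t s' \<longleftrightarrow> t = 1 \<and> s' = put_nat s i (fst s i + 1)"
  "exec A (NPred i) s t s' \<longleftrightarrow> t = 1 \<and> s' = put_nat s i (fst s i - 1)"
  "exec A (RSet l z) s t s' \<longleftrightarrow> t = 1 \<and> s' = put s l (of_int z)"
  "exec A (RCopy l l1) s t s' \<longleftrightarrow> t = 1 \<and> s' = put s l (get s l1)"
  "exec A (ROp opr l l1 l2) s t s' \<longleftrightarrow> (opr = RDiv \<longrightarrow> get s l2 \<noteq> 0) \<and>
     t = 1 \<and> s' = put s l (arith_val opr (get s l1) (get s l2))"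
  "exec A (RFetch l i j) s t s' \<longleftrightarrow> fst s i < dim_row A \<and> fst s j < dim_col A \<and>
     t = 1 \<and> s' = put s l (A $$ (fst s i, fst s j))"
  by (auto simp del: One_nat_def elim: exec.cases intro: exec.intros)

lemma exec_Seq_iff:
  "exec A (Seq P Q) s t s'' \<longleftrightarrow> (\<exists>t1 t2 s'. exec A P s t1 s' \<and> exec A Q s' t2 s'' \<and> t = t1 + t2)"
  by (rule iffI, erule exec.cases) (blast intro: exec.Seq)+

lemma exec_IfLess_iff:
  "exec A (IfLess l1 l2 P Q) s t s' \<longleftrightarrow>
     (\<exists>t'. exec A (if get s l1 < get s l2 then P else Q) s t' s' \<and> t = 1 + t')"
proof
  assume "exec A (IfLess l1 l2 P Q) s t s'"
  then show "\<exists>t'. exec A (if get s l1 < get s l2 then P else Q) s t' s' \<and> t = 1 + t'"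
    by cases auto
next
  assume "\<exists>t'. exec A (if get s l1 < get s l2 then P else Q) s t' s' \<and> t = 1 + t'"
  then show "exec A (IfLess l1 l2 P Q) s t s'"
    by (metis exec.IfTrue exec.IfFalse)
qed

text \<open>As rewrite rules these execute straight-line code symbolically, each instruction taking
  one unit from the budget.\<close>

lemma wp_basic [simp]:
  "wp A (NSet i c) Q (N, M) k \<longleftrightarrow> 0 < k \<and> Q (N(i := c), M) (k - 1)"
  "wp A (NCopy i j) Q (N, M) k \<longleftrightarrow> 0 < k \<and> Q (N(i := N j), M) (k - 1)"
  "wp A (NSucc i) Q (N, M) k \<longleftrightarrow> 0 < k \<and> Q (N(i := N i + 1), M) (k - 1)"
  "wp A (NPred i) Q (N, M) k \<longleftrightarrow> 0 < k \<and> Q (N(i := N i - 1), M) (k - 1)"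
  "wp A (RSet (m, i) z) Q (N, M) k \<longleftrightarrow>
     0 < k \<and> Q (N, M(m := (M m)(N i := of_int z))) (k - 1)"
  "wp A (RCopy (m, i) (m1, i1)) Q (N, M) k \<longleftrightarrow>
     0 < k \<and> Q (N, M(m := (M m)(N i := M m1 (N i1)))) (k - 1)"
  "wp A (ROp opr (m, i) (m1, i1) (m2, i2)) Q (N, M) k \<longleftrightarrow>
     (opr = RDiv \<longrightarrow> M m2 (N i2) \<noteq> 0) \<and> 0 < k \<and>
     Q (N, M(m := (M m)(N i := arith_val opr (M m1 (N i1)) (M m2 (N i2))))) (k - 1)"
  "wp A (RFetch (m, i) r1 r2) Q (N, M) k \<longleftrightarrow> N r1 < dim_row A \<and> N r2 < dim_col A \<and>
     0 < k \<and> Q (N, M(m := (M m)(N i := A $$ (N r1, N r2)))) (k - 1)"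
  by (auto simp: wp_def exec_basic_iff Suc_le_eq)

lemma wp_Seq [simp]: "wp A (Seq P Q) R s k \<longleftrightarrow> wp A P (wp A Q R) s k"
proof
  assume "wp A (Seq P Q) R s k"
  then obtain t1 t2 s' s'' where "exec A P s t1 s'" "exec A Q s' t2 s''" "t1 + t2 \<le> k"
    "R s'' (k - (t1 + t2))"
    by (auto simp: wp_def exec_Seq_iff)
  then show "wp A P (wp A Q R) s k"
    unfolding wp_def
    by (intro exI[of _ t1] exI[of _ s'] conjI exI[of _ t2] exI[of _ s'']) auto
next
  assume "wp A P (wp A Q R) s k"
  then obtain t1 t2 s' s'' where "exec A P s t1 s'" "t1 \<le> k" "exec A Q s' t2 s''" "t2 \<le> k - t1"
    "R s'' (k - t1 - t2)"
    by (auto simp: wp_def)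
  then show "wp A (Seq P Q) R s k"
    unfolding wp_def exec_Seq_iff
    by (intro exI[of _ "t1 + t2"] exI[of _ s''] conjI exI[of _ t1] exI[of _ t2] exI[of _ s']) auto
qed

lemma wp_IfLess [simp]:
  "wp A (IfLess (m1, i1) (m2, i2) P Q) R (N, M) k \<longleftrightarrow>
     0 < k \<and> (if M m1 (N i1) < M m2 (N i2) then wp A P R (N, M) (k - 1)
              else wp A Q R (N, M) (k - 1))"
proof
  assume "wp A (IfLess (m1, i1) (m2, i2) P Q) R (N, M) k"
  then show "0 < k \<and> (if M m1 (N i1) < M m2 (N i2) then wp A P R (N, M) (k - 1)
      else wp A Q R (N, M) (k - 1))"
    unfolding wp_def exec_IfLess_iff by (fastforce split: if_splits)
next
  assume R: "0 < k \<and> (if M m1 (N i1) < M m2 (N i2) then wp A P R (N, M) (k - 1)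
      else wp A Q R (N, M) (k - 1))"
  then obtain t s' where "exec A (if M m1 (N i1) < M m2 (N i2) then P else Q) (N, M) t s'"
    "t \<le> k - 1" "R s' (k - 1 - t)"
    by (auto simp: wp_def split: if_splits)
  with R show "wp A (IfLess (m1, i1) (m2, i2) P Q) R (N, M) k"
    unfolding wp_def exec_IfLess_iff by (intro exI[of _ "1 + t"] exI[of _ s']) auto
qed

text \<open>The invariant is indexed by the number of completed iterations, which suits upward and
  downward loops alike. Each of the n rounds costs at most K plus one for the test; the final
  failing test adds one.\<close>

lemma wp_WhileLess:
  assumes guard: "\<And>m s. I m s \<Longrightarrow> m \<le> n \<Longrightarrow> fst s i < fst s j \<longleftrightarrow> m < n"
    and body: "\<And>m s. I m s \<Longrightarrow> m < n \<Longrightarrow> wp A P (\<lambda>s' _. I (Suc m) s') s K"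
    and "I 0 s" "n * (K + 1) + 1 \<le> k"
    and post: "\<And>s' k'. I n s' \<Longrightarrow> k - (n * (K + 1) + 1) \<le> k' \<Longrightarrow> Q s' k'"
  shows "wp A (WhileLess i j P) Q s k"
proof -
  have "\<exists>t s'. exec A (WhileLess i j P) s t s' \<and> t \<le> d * (K + 1) + 1 \<and> I n s'"
    if "I m s" "m \<le> n" "d = n - m" for d m s
    using that
  proof (induction d arbitrary: m s)
    case 0
    then show ?case
      using guard[of m s] exec.WhileStop[of s i j A P]
      by (intro exI[of _ 1] exI[of _ s]) auto
  next
    case (Suc d)
    then have "m < n" "d = n - Suc m" by auto
    obtain t s' where s': "exec A P s t s'" "t \<le> K" "I (Suc m) s'"
      using body[OF Suc.prems(1) \<open>m < n\<close>] by (auto simp: wp_def)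
    obtain t' s'' where s'': "exec A (WhileLess i j P) s' t' s''" "t' \<le> d * (K + 1) + 1" "I n s''"
      using Suc.IH[OF s'(3)] \<open>m < n\<close> \<open>d = n - Suc m\<close> by auto
    have "exec A (WhileLess i j P) s (1 + t + t') s''"
      using exec.WhileStep[OF _ s'(1) s''(1)] guard[OF Suc.prems(1)] \<open>m < n\<close> by simp
    then show ?case
      using s'(2) s''(2,3) by (intro exI[of _ "1 + t + t'"] exI[of _ s'']) auto
  qed
  from this[OF \<open>I 0 s\<close>, of n] obtain t s' where
    "exec A (WhileLess i j P) s t s'" "t \<le> n * (K + 1) + 1" "I n s'"
    by auto
  then show ?thesis
    unfolding wp_def using assms(4) post[of s' "k - t"]
    by (intro exI[of _ t] exI[of _ s']) auto
qed

lemma computes_within_if_wp: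
  assumes "wp A P (\<lambda>s' _. vec n (snd s' 4) = out) (init_state n x y z \<gamma>) T"
  shows "computes_within P n A x y z \<gamma> out T"
  using assms by (auto simp: wp_def computes_within_def)

subsection \<open>The program\<close>

text \<open>Register \<open>1\<close> is the loop index \<open>i\<close>, register \<open>3\<close> is \<open>i + 1\<close>, and register \<open>2\<close> stays \<open>0\<close>, so
  that \<open>(m, 2)\<close> is a scalar variable. Arrays \<open>5\<close> and \<open>6\<close> hold the kernel \<open>p\<close> and the right-hand side
  \<open>w\<close>, with entry \<open>n\<close> left at its initial value \<open>0\<close>; arrays \<open>7\<close>, \<open>8\<close>, \<open>9\<close> hold \<open>\<alpha>\<close>, \<open>\<beta>\<close>, \<open>\<kappa>\<close>. The
  scalars are \<open>10\<close> for \<open>(g i)\<^sup>2\<close>, whose sign decides \<open>g i \<noteq> 0\<close>, \<open>11\<close> for the constant \<open>0\<close>, \<open>12\<close>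
  for temporaries, \<open>13\<close> for the partial sum and \<open>14\<close> for the flux.\<close>

definition prepare_body :: com where
  "prepare_body =
     Seq (RFetch (5, 1) 1 1)
    (Seq (ROp RAdd (5, 1) (5, 1) (3, 2))
    (Seq (ROp RDiv (6, 1) (2, 1) (0, 1))
         (NSucc 1)))"

definition forward_body :: com where
  "forward_body =
     Seq (NCopy 3 1)
    (Seq (NSucc 3)
    (Seq (ROp RMul (10, 2) (1, 1) (1, 1))
    (Seq (IfLess (11, 2) (10, 2)
            (Seq (ROp RDiv (12, 2) (0, 1) (1, 1))
            (Seq (ROp RMul (12, 2) (8, 1) (12, 2))
            (Seq (ROp RSub (7, 3) (7, 1) (12, 2))
            (Seq (RCopy (8, 3) (8, 1))
                 (RCopy (9, 3) (9, 1))))))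
            (Seq (RSet (7, 3) 1)
            (Seq (RSet (8, 3) 0)
                 (RSet (9, 3) 0))))
    (Seq (ROp RSub (12, 2) (5, 1) (5, 3))
    (Seq (ROp RMul (12, 2) (7, 3) (12, 2))
    (Seq (ROp RSub (8, 3) (8, 3) (12, 2))
    (Seq (ROp RSub (12, 2) (6, 1) (6, 3))
    (Seq (ROp RMul (12, 2) (7, 3) (12, 2))
    (Seq (ROp RSub (9, 3) (9, 3) (12, 2))
         (NSucc 1))))))))))"

definition backward_body :: com where
  "backward_body =
     Seq (NCopy 3 1)
    (Seq (NPred 1)
    (Seq (ROp RSub (12, 2) (5, 1) (5, 3))
    (Seq (ROp RMul (12, 2) (12, 2) (13, 2))
    (Seq (ROp RSub (14, 2) (14, 2) (12, 2))
    (Seq (ROp RSub (12, 2) (6, 1) (6, 3))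
    (Seq (ROp RAdd (14, 2) (14, 2) (12, 2))
    (Seq (ROp RMul (10, 2) (1, 1) (1, 1))
         (IfLess (11, 2) (10, 2)
            (Seq (ROp RDiv (4, 1) (14, 2) (1, 1))
            (Seq (ROp RMul (12, 2) (0, 1) (4, 1))
                 (ROp RSub (13, 2) (13, 2) (12, 2))))
            (Seq (ROp RDiv (12, 2) (9, 1) (8, 1))
            (Seq (ROp RSub (4, 1) (13, 2) (12, 2))
            (Seq (ROp RDiv (4, 1) (4, 1) (0, 1))
                 (RCopy (13, 2) (12, 2)))))))))))))"

text \<open>Of the start values only \<open>\<beta>\<close> at index 0 must be set, since unwritten
  entries are 0. After the forward loop register 1 equals n, where F_n = 0 turns the relation into
  S_n = \<open>\<kappa>\<close> / \<open>\<beta>\<close>. The last loop counts register 1 down to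
  0.\<close>

definition solver :: com where
  "solver =
     Seq (WhileLess 1 0 prepare_body)
    (Seq (NSet 1 0)
    (Seq (RSet (8, 2) 1)
    (Seq (WhileLess 1 0 forward_body)
    (Seq (ROp RDiv (13, 2) (9, 1) (8, 1))
         (WhileLess 2 1 backward_body)))))"

text \<open>A max kernel is determined by its diagonal, so one fetched entry per index
  suffices.\<close>

lemma wp_prepare_body:
  assumes "dim_row A = n" "dim_col A = n" "i < n"
    and p: "p i = A $$ (i, i) + \<gamma>" and w: "w i = v i / c i" and "c i \<noteq> 0"
    and s: "N 0 = n" "N 1 = i" "N 2 = 0" "M 0 = c" "M 2 = v" "M 3 0 = \<gamma>"
      "M 5 = (\<lambda>j. if j < i then p j else 0)" "M 6 = (\<lambda>j. if j < i then w j else 0)"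
  shows "wp A prepare_body
    (\<lambda>s' _. s' = (N(1 := Suc i), M(5 := (\<lambda>j. if j < Suc i then p j else 0),
                               6 := (\<lambda>j. if j < Suc i then w j else 0)))) (N, M) 4"
  unfolding prepare_body_def using assms
  by (auto simp: fun_eq_iff less_Suc_eq)

text \<open>Array 14 is tracked because its initial zero serves as F_n in the backward
  sweep.\<close>

definition forward_inv ::
  "nat \<Rightarrow> (nat \<Rightarrow> real) \<Rightarrow> (nat \<Rightarrow> real) \<Rightarrow> (nat \<Rightarrow> real) \<Rightarrow> (nat \<Rightarrow> real) \<Rightarrow> nat \<Rightarrow> state \<Rightarrow> bool"
  where
  "forward_inv n c g p w i s \<longleftrightarrow>
     fst s 0 = n \<and> fst s 1 = i \<and> fst s 2 = 0 \<and>
     snd s 0 = c \<and> snd s 1 = g \<and> snd s 5 = p \<and> snd s 6 = w \<and>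
     snd s 11 = (\<lambda>_. 0) \<and> snd s 14 = (\<lambda>_. 0) \<and>
     (\<forall>j\<le>i. snd s 7 j = fst (elim_coeffs c g p j) \<and> snd s 8 j = snd (elim_coeffs c g p j) \<and>
        snd s 9 j = elim_rhs c g p w j)"

lemma wp_forward_body:
  assumes "forward_inv n c g p w i s"
  shows "wp A forward_body (\<lambda>s' _. forward_inv n c g p w (Suc i) s') s 16"
proof -
  obtain N M where s: "s = (N, M)" by fastforce
  obtain \<alpha> \<beta> where ab: "elim_coeffs c g p i = (\<alpha>, \<beta>)" by fastforce
  have inv: "N 0 = n" "N (Suc 0) = i" "N 2 = 0" "M 0 = c" "M (Suc 0) = g" "M 5 = p" "M 6 = w"
    "M 11 = (\<lambda>_. 0)" "M 14 = (\<lambda>_. 0)" "M 7 i = \<alpha>" "M 8 i = \<beta>"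
    "M 9 i = elim_rhs c g p w i"
    using assms by (auto simp: s ab forward_inv_def)
  have old: "M 7 j = fst (elim_coeffs c g p j) \<and> M 8 j = snd (elim_coeffs c g p j) \<and>
      M 9 j = elim_rhs c g p w j" if "j \<le> i" for j
    using assms that by (auto simp: s forward_inv_def)
  have sq: "0 < g i * g i \<longleftrightarrow> g i \<noteq> 0"
    by (simp add: zero_less_mult_iff) linarith
  show ?thesis
    unfolding forward_body_def s
    by (cases "g i = 0") (simp_all add: inv old sq forward_inv_def le_Suc_eq ab)
qed

definition backward_inv ::
  "nat \<Rightarrow> (nat \<Rightarrow> real) \<Rightarrow> (nat \<Rightarrow> real) \<Rightarrow> (nat \<Rightarrow> real) \<Rightarrow> (nat \<Rightarrow> real) \<Rightarrow> (nat \<Rightarrow> real) \<Rightarrow>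
     nat \<Rightarrow> state \<Rightarrow> bool" where
  "backward_inv n c g p w x i s \<longleftrightarrow>
     fst s 0 = n \<and> fst s 1 = i \<and> fst s 2 = 0 \<and>
     snd s 0 = c \<and> snd s 1 = g \<and> snd s 5 = p \<and> snd s 6 = w \<and> snd s 11 = (\<lambda>_. 0) \<and>
     (\<forall>j\<le>n. snd s 8 j = snd (elim_coeffs c g p j) \<and> snd s 9 j = elim_rhs c g p w j) \<and>
     snd s 13 0 = psum c x i \<and> snd s 14 0 = flux n g x i \<and>
     (\<forall>j. i \<le> j \<longrightarrow> j < n \<longrightarrow> snd s 4 j = x j)"

text \<open>\<open>flux_Suc\<close> solved for F_i gives the flux. If g_i is nonzero, x_i = F_i /
  g_i. If g_i = 0, the relation at i yields S_i = \<open>\<kappa>\<close> / \<open>\<beta>\<close>,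
  and x_i is the increment of S divided by c_i; surjectivity ensures that \<open>\<beta>\<close> is
  nonzero there.\<close>

lemma wp_backward_body:
  assumes surj: "\<And>w. \<exists>x. solves n c g p w x"
    and x: "solves n c g p w x" and "p n = 0" "w n = 0" "\<And>j. j < n \<Longrightarrow> c j \<noteq> 0"
    and "i < n" and inv: "backward_inv n c g p w x (Suc i) s"
  shows "wp A backward_body (\<lambda>s' _. backward_inv n c g p w x i s') s 13"
proof -
  have fl: "flux n g x (Suc i) - (p i - p (Suc i)) * psum c x (Suc i) + (w i - w (Suc i)) =
      g i * x i" "flux n g x i = g i * x i"
    using flux_Suc[OF x \<open>p n = 0\<close> \<open>w n = 0\<close> \<open>i < n\<close>] \<open>i < n\<close> by (auto simp: flux_def)
  have be: "snd (elim_coeffs c g p i) \<noteq> 0" "elim_rhs c g p w i / snd (elim_coeffs c g p i) = psum c x i"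
    if "g i = 0"
  proof -
    show *: "snd (elim_coeffs c g p i) \<noteq> 0"
      using elim_coeffs_snd_nonzero[OF surj \<open>p n = 0\<close>] that \<open>i < n\<close> by simp
    show "elim_rhs c g p w i / snd (elim_coeffs c g p i) = psum c x i"
      using elim_relation[OF x \<open>p n = 0\<close> \<open>w n = 0\<close>, of i] that \<open>i < n\<close> * fl(2)
      by (simp add: field_simps)
  qed
  obtain N M where s: "s = (N, M)" by fastforce
  have st: "N 0 = n" "N (Suc 0) = Suc i" "N 2 = 0" "M 0 = c" "M (Suc 0) = g" "M 5 = p" "M 6 = w"
    "M 11 = (\<lambda>_. 0)" "M 8 i = snd (elim_coeffs c g p i)" "M 9 i = elim_rhs c g p w i"
    "M 13 0 = psum c x (Suc i)" "M 14 0 = flux n g x (Suc i)"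
    using inv \<open>i < n\<close> by (auto simp: s backward_inv_def)
  have old_coeffs: "M 8 j = snd (elim_coeffs c g p j) \<and> M 9 j = elim_rhs c g p w j" if "j \<le> n" for j
    using inv that by (auto simp: s backward_inv_def)
  have old_result: "M 4 j = x j" if "j \<noteq> i" "i \<le> j" "j < n" for j
    using inv that by (auto simp: s backward_inv_def)
  have sq: "0 < g i * g i \<longleftrightarrow> g i \<noteq> 0"
    by (simp add: zero_less_mult_iff) linarith
  show ?thesis
    unfolding backward_body_def s
    by (cases "g i = 0")
      (simp_all add: st old_coeffs old_result sq backward_inv_def
        fl(1)[unfolded psum_Suc] fl(2) be psum_Suc assms(5,6))
qed

text \<open>The three loops cost at most 5n + 1, 17n + 1 and 14n + 1, and three single instructions
  are added: 36n + 6 in total, which is at most 42n for n \<ge> 1.\<close>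

lemma wp_solver:
  fixes A :: "real mat" and cv gv v :: "real vec" and \<gamma> :: real and n :: nat
  defines "c \<equiv> vec_array cv" and "g \<equiv> vec_array gv"
  defines "p \<equiv> \<lambda>i. if i < n then A $$ (i, i) + \<gamma> else 0"
    and "w \<equiv> \<lambda>i. if i < n then vec_array v i / c i else 0"
  assumes surj: "\<And>w. \<exists>x. solves n c g p w x"
    and x: "solves n c g p w x"
    and "dim_row A = n" "dim_col A = n" "n \<ge> 1" and c: "\<And>j. j < n \<Longrightarrow> c j \<noteq> 0"
  shows "wp A solver (\<lambda>s' _. \<forall>j<n. snd s' 4 j = x j) (init_state n cv gv v \<gamma>) (42 * n)"
proof -
  obtain N M where init: "init_state n cv gv v \<gamma> = (N, M)" by fastforce
  then have N: "N = (\<lambda>_. 0)(0 := n)" and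
    M: "M = (\<lambda>_ _. 0)(0 := c, 1 := g, 2 := vec_array v, 3 := (\<lambda>_. 0)(0 := \<gamma>))"
    by (simp_all add: init_state_def c_def g_def)
  define I where "I i = (N(1 := i), M(5 := (\<lambda>j. if j < i then p j else 0),
      6 := (\<lambda>j. if j < i then w j else 0)))" for i
  have pw: "p n = 0" "w n = 0"
    by (simp_all add: p_def w_def)
  have be: "snd (elim_coeffs c g p n) \<noteq> 0"
    using elim_coeffs_snd_nonzero[OF surj pw(1)] by simp
  have S: "elim_rhs c g p w n / snd (elim_coeffs c g p n) = psum c x n"
    using elim_relation[OF x pw, of n] be by (simp add: field_simps flux_def)
  have backward: "wp A (WhileLess 2 1 backward_body) (\<lambda>s' _. \<forall>j<n. snd s' 4 j = x j) s k"
    if "backward_inv n c g p w x n s" "Suc (n * 14) \<le> k" for s k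
  \<comment> \<open>After m rounds of the downward sweep the current index is n - m.\<close>
  proof (rule wp_WhileLess[where I = "\<lambda>m. backward_inv n c g p w x (n - m)" and n = n and K = 13])
    fix m s
    assume "backward_inv n c g p w x (n - m) s" "m < n"
    then show "wp A backward_body (\<lambda>s' _. backward_inv n c g p w x (n - Suc m) s') s 13"
      using wp_backward_body[OF surj x pw c, of "n - Suc m" s] by (simp add: Suc_diff_Suc)
  qed (use that in \<open>auto simp: backward_inv_def\<close>)
  have forward: "wp A (WhileLess 1 0 forward_body)
      (wp A (ROp RDiv (13, 2) (9, 1) (8, 1))
        (wp A (WhileLess 2 1 backward_body) (\<lambda>s' _. \<forall>j<n. snd s' 4 j = x j))) s k"
    if "forward_inv n c g p w 0 s" "n * 31 + 3 \<le> k" for s k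
  proof (rule wp_WhileLess[where I = "forward_inv n c g p w" and n = n and K = 16])
    fix s k'
    assume s: "forward_inv n c g p w n s" and k': "k - (n * (16 + 1) + 1) \<le> k'"
    obtain N M where s_eq: "s = (N, M)" by fastforce
    have k'': "Suc (Suc (n * 14)) \<le> k'"
      using that(2) k' by (simp add: algebra_simps)
    show "wp A (ROp RDiv (13, 2) (9, 1) (8, 1))
        (wp A (WhileLess 2 1 backward_body) (\<lambda>s' _. \<forall>j<n. snd s' 4 j = x j)) s k'"
    proof -
      have st: "N 1 = n" "N 2 = 0" "M 8 n = snd (elim_coeffs c g p n)"
        "M 9 n = elim_rhs c g p w n"
        using s by (auto simp: s_eq forward_inv_def)
      have "backward_inv n c g p w x n (N, M(13 := (M 13)(0 := psum c x n)))"
        using s by (auto simp: s_eq forward_inv_def backward_inv_def flux_def)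
      from backward[OF this, of "k' - 1"] k'' show ?thesis
        using be st S by (simp add: s_eq)
    qed
  qed (use that wp_forward_body in \<open>auto simp: forward_inv_def\<close>)
  have inv0: "forward_inv n c g p w 0
      (N(1 := 0), M(5 := p, 6 := w, 8 := (\<lambda>_. 0)(0 := 1)))"
    by (simp add: forward_inv_def N M)
  have pw_eq: "(\<lambda>j. if j < n then p j else 0) = p" "(\<lambda>j. if j < n then w j else 0) = w"
    by (auto simp: p_def w_def)
  show ?thesis
    unfolding solver_def init wp_Seq
  proof (rule wp_WhileLess[where I = "\<lambda>i s. s = I i" and n = n and K = 4])
    fix m s
    assume "s = I m" "m < n"
    have "wp A prepare_body
        (\<lambda>s' _. s' = ((fst (I m))(1 := Suc m), (snd (I m))(5 := (\<lambda>j. if j < Suc m then p j else 0),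
           6 := (\<lambda>j. if j < Suc m then w j else 0)))) (fst (I m), snd (I m)) 4"
      by (rule wp_prepare_body[OF assms(7,8) \<open>m < n\<close>, where \<gamma> = \<gamma> and v = "vec_array v" and c = c])
        (use c \<open>m < n\<close> in \<open>auto simp: p_def w_def I_def N M\<close>)
    then show "wp A prepare_body (\<lambda>s' _. s' = I (Suc m)) s 4"
      by (simp add: \<open>s = I m\<close> I_def fun_upd_twist)
  next
    show "(N, M) = I 0"
      by (auto simp: I_def N M fun_eq_iff)
  next
    fix s k'
    assume s: "s = I n" and k': "42 * n - (n * (4 + 1) + 1) \<le> k'"
    have k'': "Suc (Suc (n * 31 + 3)) \<le> k'"
      using k' \<open>n \<ge> 1\<close> by (simp add: algebra_simps)
    show "wp A (NSet 1 0)
        (wp A (RSet (8, 2) 1)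
          (wp A (WhileLess 1 0 forward_body)
            (wp A (ROp RDiv (13, 2) (9, 1) (8, 1))
              (wp A (WhileLess 2 1 backward_body) (\<lambda>s' _. \<forall>j<n. snd s' 4 j = x j))))) s k'"
      using forward[OF inv0, of "k' - Suc (Suc 0)"] k''
      by (simp add: s I_def pw_eq N M fun_upd_twist)
  qed (use \<open>n \<ge> 1\<close> in \<open>auto simp: I_def N\<close>)
qed

subsection \<open>The Hessian\<close>

lemma ones_times_row_carrier [simp]: "v \<in> carrier_vec n \<Longrightarrow> ones_times_row v \<in> carrier_mat n n"
  by (auto simp: ones_times_row_def)

lemma ones_times_row_entry:
  "i < dim_vec v \<Longrightarrow> j < dim_vec v \<Longrightarrow> ones_times_row v $$ (i, j) = v $ j"
  by (simp add: ones_times_row_def scalar_prod_def mat_of_cols_index mat_of_rows_index)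

lemma H_mat_carrier [simp]: "H_mat n \<alpha> \<gamma> c b a r f \<in> carrier_mat n n"
  unfolding H_mat_def
  by (intro mult_carrier_mat[of _ n n] add_carrier_mat smult_carrier_mat diag_of_carrier
      ones_times_row_carrier A_mat_carrier c_hat_carrier g_vec_carrier)

text \<open>The rank-one term contributes \<open>\<gamma>\<close> times the coefficient of column j,
  so it merely shifts every entry of A_r by \<open>\<gamma>\<close>.\<close>

lemma H_mat_entry:
  assumes "i < n" "j < n"
  shows "H_mat n \<alpha> \<gamma> c b a r f $$ (i, j) = c_hat n c $ i *
    ((if i = j then g_vec n \<alpha> c b a r f $ i else 0) + (A_mat n r b $$ (i, j) + \<gamma>) * c_hat n c $ j)"
proof -
  have A: "A_mat n r b * diag_of (c_hat n c) =
      mat n n (\<lambda>(i, j). A_mat n r b $$ (i, j) * c_hat n c $ j)"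
    using mat_diag_mult_right[OF A_mat_carrier[of n r b], of "\<lambda>i. c_hat n c $ i"]
    by (simp add: diag_of_def carrier_vecD[OF c_hat_carrier])
  let ?X = "diag_of (g_vec n \<alpha> c b a r f) + A_mat n r b * diag_of (c_hat n c)
         + \<gamma> \<cdot>\<^sub>m ones_times_row (c_hat n c)"
  have X: "?X \<in> carrier_mat n n"
    by (intro mult_carrier_mat[of _ n n] add_carrier_mat smult_carrier_mat diag_of_carrier
      ones_times_row_carrier A_mat_carrier c_hat_carrier g_vec_carrier)
  have "H_mat n \<alpha> \<gamma> c b a r f = mat n n (\<lambda>(i, j). c_hat n c $ i * ?X $$ (i, j))"
    unfolding H_mat_def using mat_diag_mult_left[OF X, of "\<lambda>i. c_hat n c $ i"]
    by (simp add: diag_of_def carrier_vecD[OF c_hat_carrier])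
  moreover have "?X $$ (i, j) = (if i = j then g_vec n \<alpha> c b a r f $ i else 0) +
      (A_mat n r b $$ (i, j) + \<gamma>) * c_hat n c $ j"
    using assms carrier_matD[OF ones_times_row_carrier[OF c_hat_carrier[of n c]]]
    unfolding A
    by (simp add: diag_of_def mat_diag_def ones_times_row_entry algebra_simps
        carrier_vecD[OF c_hat_carrier] carrier_vecD[OF g_vec_carrier])
  ultimately show ?thesis
    using assms by simp
qed

text \<open>Writing the right-hand side as a multiple of the row coefficient lets \<open>w\<close>
  be prescribed freely, as the surjectivity argument requires.\<close>

lemma solves_if_H_mat_mult_vec:
  fixes n \<alpha> \<gamma> c b a r f
  defines "A \<equiv> A_mat n r b"
  assumes R: "ritz_setting n b \<gamma> a r a0 r0" and c: "\<forall>i\<in>{1..n}. c i \<noteq> 0"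
    and x: "x \<in> carrier_vec n"
    and Hx: "\<And>i. i < n \<Longrightarrow> (H_mat n \<alpha> \<gamma> c b a r f *\<^sub>v x) $ i = c (Suc i) * w i"
  shows "solves n (vec_array (c_hat n c)) (vec_array (g_vec n \<alpha> c b a r f))
    (\<lambda>i. if i < n then A $$ (i, i) + \<gamma> else 0) w (vec_array x)"
  unfolding solves_def
proof (intro allI impI)
  fix i assume i: "i < n"
  let ?c = "vec_array (c_hat n c)" and ?g = "vec_array (g_vec n \<alpha> c b a r f)"
    and ?p = "\<lambda>i. if i < n then A $$ (i, i) + \<gamma> else 0"
  have va: "vec_array (c_hat n c) k = c (Suc k)"
    "vec_array (g_vec n \<alpha> c b a r f) k = g_vec n \<alpha> c b a r f $ k"
    "vec_array x k = x $ k" "c_hat n c $ k = c (Suc k)" if "k < n" for k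
    using that x by (auto simp: vec_array_def c_hat_def g_vec_def)
  have "(H_mat n \<alpha> \<gamma> c b a r f *\<^sub>v x) $ i =
      (\<Sum>j<n. H_mat n \<alpha> \<gamma> c b a r f $$ (i, j) * x $ j)"
    using i x carrier_matD[OF H_mat_carrier[of n \<alpha> \<gamma> c b a r f]]
    by (auto simp: scalar_prod_def lessThan_atLeast0 intro!: sum.cong)
  also have "\<dots> = (\<Sum>j<n. c (Suc i) * ((if i = j then ?g i * vec_array x i else 0) +
      ?p (max i j) * (?c j * vec_array x j)))"
  proof (rule sum.cong[OF refl])
    fix j assume "j \<in> {..<n}"
    then have j: "j < n" by simp
    have "A $$ (i, j) = A $$ (max i j, max i j)"
      using A_mat_entry[OF R i j] A_mat_entry[OF R, of "max i j" "max i j"] i j by (simp add: A_def)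
    then show "H_mat n \<alpha> \<gamma> c b a r f $$ (i, j) * x $ j = c (Suc i) *
        ((if i = j then ?g i * vec_array x i else 0) + ?p (max i j) * (?c j * vec_array x j))"
      using i j by (simp add: H_mat_entry va A_def[symmetric] algebra_simps)
  qed
  also have "\<dots> = c (Suc i) * (?g i * vec_array x i +
      (\<Sum>j<n. ?p (max i j) * (?c j * vec_array x j)))"
    using i by (simp add: sum_distrib_left[symmetric] sum.distrib)
  finally show "?g i * vec_array x i + (\<Sum>j<n. ?p (max i j) * (?c j * vec_array x j)) = w i"
    using Hx[OF i] c i by auto
qed

text \<open>Invertibility of H enters twice: it provides the solution to be computed, and
  solvability for every \<open>w\<close>, which keeps the divisors of the elimination
  nonzero.\<close>

lemma solver_computes_inverse_action:
  assumes R: "ritz_setting n b \<gamma> a r a0 r0" and c: "\<forall>i\<in>{1..n}. c i \<noteq> 0"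
    and H: "invertible_mat (H_mat n \<alpha> \<gamma> c b a r f)" and v: "v \<in> carrier_vec n"
  shows "computes_within solver n (A_mat n r b) (c_hat n c) (g_vec n \<alpha> c b a r f) v \<gamma>
    (mat_inv (H_mat n \<alpha> \<gamma> c b a r f) *\<^sub>v v) (42 * n)"
proof -
  let ?H = "H_mat n \<alpha> \<gamma> c b a r f" and ?A = "A_mat n r b"
  let ?c = "vec_array (c_hat n c)" and ?g = "vec_array (g_vec n \<alpha> c b a r f)"
    and ?p = "\<lambda>i. if i < n then ?A $$ (i, i) + \<gamma> else 0"
  note Hinv = mat_inverse_invertible_mat[OF H_mat_carrier H]
  have sol: "?H *\<^sub>v (mat_inv ?H *\<^sub>v u) = u" "mat_inv ?H *\<^sub>v u \<in> carrier_vec n"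
    if "u \<in> carrier_vec n" for u
    using that Hinv by (simp_all add: assoc_mult_mat_vec[symmetric, of _ n n _ n])
  have c_nz: "?c j \<noteq> 0" "?c j = c (Suc j)" if "j < n" for j
    using c that by (auto simp: vec_array_def c_hat_def)
  have surj: "\<exists>x. solves n ?c ?g ?p w x" for w
  proof -
    define u where "u = vec n (\<lambda>i. c (Suc i) * w i)"
    have u: "u \<in> carrier_vec n" by (simp add: u_def)
    have "(?H *\<^sub>v (mat_inv ?H *\<^sub>v u)) $ i = c (Suc i) * w i" if "i < n" for i
      unfolding sol(1)[OF u] using that by (simp add: u_def)
    then show ?thesis
      using solves_if_H_mat_mult_vec[OF R c sol(2)[OF u]] by blast
  qed
  let ?x = "mat_inv ?H *\<^sub>v v"
  have "solves n ?c ?g ?p (\<lambda>i. if i < n then vec_array v i / ?c i else 0) (vec_array ?x)"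
  proof (rule solves_if_H_mat_mult_vec[OF R c sol(2)[OF v]])
    fix i assume "i < n"
    then show "(?H *\<^sub>v ?x) $ i = c (Suc i) * (if i < n then vec_array v i / ?c i else 0)"
      unfolding sol(1)[OF v] using c_nz[of i] v by (simp add: vec_array_def)
  qed
  then have "wp ?A solver (\<lambda>s' _. \<forall>j<n. snd s' 4 j = vec_array ?x j)
      (init_state n (c_hat n c) (g_vec n \<alpha> c b a r f) v \<gamma>) (42 * n)"
    using R c_nz by (intro wp_solver surj) (auto simp: ritz_setting_def A_mat_def)
  moreover have "vec n h = ?x" if "\<forall>j<n. h j = vec_array ?x j" for h
    using that by (intro eq_vecI) (simp_all add: vec_array_def carrier_matD[OF Hinv(1)])
  ultimately show ?thesis
    by (intro computes_within_if_wp) (auto simp: wp_def)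
qed

text \<open>One program and one time bound, here 42n, serve all dimensions and data. The claims on
  the inverse of A_r are conditional because for r0 = 0 the function \<open>r\<close> may vanish and
  A_r be singular.\<close>

theorem mainTheorem7:
  shows
    "(\<exists>(P :: com) (T :: nat \<Rightarrow> nat).
        (\<lambda>n. real (T n)) \<in> O(\<lambda>n. real n) \<and>
        (\<forall>n b c \<alpha> \<gamma> a r f a0 r0.
           ritz_setting n b \<gamma> a r a0 r0 \<longrightarrow> (\<forall>i\<in>{1..n}. c i \<noteq> 0) \<longrightarrow>
           invertible_mat (H_mat n \<alpha> \<gamma> c b a r f) \<longrightarrow>
           (\<forall>v \<in> carrier_vec n.
              computes_within P n (A_mat n r b) (c_hat n c) (g_vec n \<alpha> c b a r f) v \<gamma>
                (mat_inv (H_mat n \<alpha> \<gamma> c b a r f) *\<^sub>v v) (T n)))) \<and>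
     (\<forall>n b c \<alpha> \<gamma> a r f a0 r0.
        ritz_setting n b \<gamma> a r a0 r0 \<longrightarrow>
        (r0 > 0 \<longrightarrow> invertible_mat (A_mat n r b)) \<and>
        (invertible_mat (A_mat n r b) \<longrightarrow>
           tridiagonal (mat_inv (A_mat n r b)) \<and>
           ((\<forall>i\<in>{1..n}. c i \<noteq> 0) \<longrightarrow>
              diag_of (g_vec n \<alpha> c b a r f) + A_mat n r b * diag_of (c_hat n c) =
              (diag_of (g_vec n \<alpha> c b a r f) * mat_inv (diag_of (c_hat n c))
                 * mat_inv (A_mat n r b) + 1\<^sub>m n)
              * A_mat n r b * diag_of (c_hat n c))))"
proof (intro conjI)
  show "\<exists>(P :: com) (T :: nat \<Rightarrow> nat).
        (\<lambda>n. real (T n)) \<in> O(\<lambda>n. real n) \<and>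
        (\<forall>n b c \<alpha> \<gamma> a r f a0 r0.
           ritz_setting n b \<gamma> a r a0 r0 \<longrightarrow> (\<forall>i\<in>{1..n}. c i \<noteq> 0) \<longrightarrow>
           invertible_mat (H_mat n \<alpha> \<gamma> c b a r f) \<longrightarrow>
           (\<forall>v \<in> carrier_vec n.
              computes_within P n (A_mat n r b) (c_hat n c) (g_vec n \<alpha> c b a r f) v \<gamma>
                (mat_inv (H_mat n \<alpha> \<gamma> c b a r f) *\<^sub>v v) (T n)))"
    using solver_computes_inverse_action
    by (intro exI[of _ solver] exI[of _ "\<lambda>n. 42 * n"]) auto
qed (auto simp: c_hat_def intro!: A_mat_invertible A_mat_inverse_tridiagonal
    add_mult_factorization diag_of_invertible)

end
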